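(* Let $q$ be a prime power and let $n,t,r$ be integers with $n>t>r\geq 2$ and $r\equiv n\pmod t$. Let $c_1,c_2,f_q(n,t),g_q(n,t)$ be as defined in the context. If $2r\leq t\leq \Theta_r$, then \[ g_q(n,t)-f_q(n,t)=\left\lfloor\frac{q^r}{2}\right\rfloor-(q-1)(t-2)-c_1+c_2 . \] Consequently, for $\left\lceil\frac{\Theta_r}{2}\right\rceil+4\leq t\leq \Theta_r$ with $q>2$, and for $\left\lceil\frac{\Theta_r}{2}\right\rceil+5\leq t\leq \Theta_r$ with $q=2$, we have \[ g_q(n,t)-f_q(n,t)<0, \] and thus the upper bound $g_q(n,t)$ for $\mu_q(n,t)$ is tighter than the Drake--Freeman upper bound $f_q(n,t)$ for $\mu_q(n,t)$.
   Context: For an integer $i\geq 1$, $\Theta_i=(q^i-1)/(q-1)$. A partial $(t-1)$-spread of the projective space $\mathrm{PG}(n-1,q)$ over $\mathbb{F}_q$ is a collection of pairwise disjoint (projective) $(t-1)$-dimensional subspaces (equivalently, $t$-dimensional vector subspaces of $\mathbb{F}_q^n$ pairwise intersecting only in $0$), and $\mu_q(n,t)$ is the maximum size of such a collection. $c_1$ is the integer with $c_1\equiv t-2\pmod q$ and $0\leq c_1<q$; $c_2=q$ if $q^2\mid \big((q-1)(t-2)+c_1\big)$ and $c_2=0$ otherwise. $f_q(n,t)$ is the Drake--Freeman upper bound for $\mu_q(n,t)$ (valid when $r>0$): \[ f_q(n,t)=\frac{q^n-q^{t+r}}{q^t-1}+q^r-\lfloor\omega\rfloor-1,\qquad 2\omega=\sqrt{4q^t(q^t-q^r)+1}-(2q^t-2q^r+1).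 \] $g_q(n,t)$ is the following quantity, which is an upper bound for $\mu_q(n,t)$ when $2\leq r<t\leq\Theta_r$: \[ g_q(n,t)=\frac{q^n-q^{t+r}}{q^t-1}+q^r-(q-1)(t-2)-c_1+c_2 . \] *)

theory Defs
  imports "HOL-Analysis.Analysis" "HOL-Number_Theory.Number_Theory"
begin

definition theta :: "nat \<Rightarrow> nat \<Rightarrow> real" where
  "theta q i = (real q ^ i - 1) / (real q - 1)"

text \<open>
  A partial \<open>(t-1)\<close>-spread of \<open>PG(n-1,q)\<close>: \<open>'a\<close> is the field with \<open>q\<close> elements,
  \<open>'n\<close> an index type with \<open>n\<close> elements, and the members are given as \<open>t\<close>-dimensional vector
  subspaces. The constants \<open>vec.subspace\<close> and \<open>vec.dim\<close> are those over the field \<open>'a\<close>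
  (\<open>subspace\<close> and \<open>dim\<close> without the qualifier are over the reals).
\<close>
definition partial_spread :: "nat \<Rightarrow> ('a::field ^ 'n) set set \<Rightarrow> bool" where
  "partial_spread t S \<longleftrightarrow>
     (\<forall>U\<in>S. vec.subspace U \<and> vec.dim U = t) \<and>
     (\<forall>U\<in>S. \<forall>W\<in>S. U \<noteq> W \<longrightarrow> U \<inter> W = {0})"

definition mu :: "('a::{field,finite} ^ 'n) itself \<Rightarrow> nat \<Rightarrow> nat" where
  "mu _ t = Max {card S |S :: ('a ^ 'n) set set. partial_spread t S}"

definition c1 :: "nat \<Rightarrow> nat \<Rightarrow> int" where
  "c1 q t = (int t - 2) mod int q"

definition c2 :: "nat \<Rightarrow> nat \<Rightarrow> int" where
  "c2 q t = (if (int q)^2 dvd (int q - 1) * (int t - 2) + c1 q t then int q else 0)"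

definition omega :: "nat \<Rightarrow> nat \<Rightarrow> nat \<Rightarrow> real" where
  "omega q t r =
     (sqrt (4 * real q ^ t * (real q ^ t - real q ^ r) + 1)
        - (2 * real q ^ t - 2 * real q ^ r + 1)) / 2"

text \<open>
  In the two bounds below, \<open>r\<close> is the residue of \<open>n\<close> modulo \<open>t\<close> with \<open>0 \<le> r < t\<close>.
\<close>
definition f_bound :: "nat \<Rightarrow> nat \<Rightarrow> nat \<Rightarrow> real" where
  "f_bound q n t = (let r = n mod t in
     (real q ^ n - real q ^ (t + r)) / (real q ^ t - 1) + real q ^ r
       - of_int \<lfloor>omega q t r\<rfloor> - 1)"

definition g_bound :: "nat \<Rightarrow> nat \<Rightarrow> nat \<Rightarrow> real" where
  "g_bound q n t = (let r = n mod t in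
     (real q ^ n - real q ^ (t + r)) / (real q ^ t - 1) + real q ^ r
       - (real q - 1) * (real t - 2) - of_int (c1 q t) + of_int (c2 q t))"

end

theory Submission
  imports Defs
begin

text \<open>
  Put \<open>z = theta q r + 1 - t\<close>. The bound \<open>g_bound\<close> follows from Kurz's bound
  \<open>(q ^ n - q ^ (t + r)) / (q ^ t - 1) + 1 + z (q - 1)\<close>, which holds for \<open>0 \<le> z < t\<close>. Suppose a
  partial spread has exactly one member more, and count the holes, i.e. the nonzero vectors covered
  by no member. A subspace of codimension at most \<open>t - k\<close> contains
  \<open>(q - 1) m q ^ k - q ^ k + 1 + (q - 1) z\<close> holes for some integer \<open>m\<close>. For the whole space and
  \<open>k = t\<close> this \<open>m\<close> is \<open>t - 1\<close>, and cutting with a hyperplane that contains at most the average number of holes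
  lowers \<open>m\<close>. At \<open>k = z + 1\<close> we arrive at \<open>m \<le> z\<close>, which the second moment of the number of
  holes in a hyperplane section excludes.

  Averages are taken over all normal vectors \<open>c\<close> of the ambient space, including \<open>0\<close> and those
  normal to the whole current subspace, so that no dimension has to be tracked.
\<close>

section \<open>Hyperplane sections of subspaces over a finite field\<close>

definition perp :: "'a::field ^ 'n \<Rightarrow> ('a ^ 'n) set" where
  "perp c = {v. scalar_product c v = 0}"

lemma scalar_product_add_right: "scalar_product c (v + w) = scalar_product c v + scalar_product c w"
  by (simp add: scalar_product_def distrib_left sum.distrib)

lemma scalar_product_scale_right:
  "scalar_product c (a *s v) = a * scalar_product (c :: 'a::field ^ 'n) v"
  by (simp add: scalar_product_def sum_distrib_left mult.left_commute)

lemma scalar_product_commute: "scalar_product c v = scalar_product v (c :: 'a::field ^ 'n)"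
  by (simp add: scalar_product_def mult.commute)

lemma scalar_product_axis_left: "scalar_product (axis i a) v = a * (v :: 'a::field ^ 'n) $ i"
  unfolding scalar_product_def
  by (subst sum.mono_neutral_right[of UNIV "{i}"]) (auto simp: axis_def)

lemma perp_commute: "v \<in> perp c \<longleftrightarrow> c \<in> perp v"
  by (simp add: perp_def scalar_product_commute)

lemma subspace_perp: "vec.subspace (perp c)"
  unfolding vec.subspace_def perp_def
  by (auto simp: scalar_product_add_right scalar_product_scale_right)
     (simp add: scalar_product_def)

lemma card_field_ge_2: "2 \<le> CARD('a::{field,finite})"
  using card_mono[of "UNIV :: 'a set" "{0, 1}"] by simp

text \<open>Adjoining an independent vector \<open>b\<close> multiplies the size of the span by
  \<open>CARD('a)\<close>, because each vector of the new span is uniquely \<open>a *s b + v\<close>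
  with \<open>v\<close> in the old one.\<close>

lemma card_subspace:
  fixes U :: "('a::{field,finite} ^ 'n) set"
  assumes "vec.subspace U"
  shows "card U = CARD('a) ^ vec.dim U"
proof -
  have span: "card (vec.span B) = CARD('a) ^ card B" if "vec.independent B" for B :: "('a ^ 'n) set"
  proof -
    have "finite B" by simp
    then show ?thesis using that
    proof (induction B rule: finite_induct)
      case (insert b B)
      have b: "b \<notin> vec.span B" and B: "vec.independent B"
        using insert.prems insert.hyps by (simp_all add: vec.independent_insert)
      have "inj_on (\<lambda>(a, v). a *s b + v) (UNIV \<times> vec.span B)"
      proof (clarsimp simp: inj_on_def)
        fix a v a' v'
        assume vv': "v \<in> vec.span B" "v' \<in> vec.span B" and eq: "a *s b + v = a' *s b + v'"
        have "(a - a') *s b = v' - v"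
          using eq by (simp add: vec.scale_left_diff_distrib algebra_simps)
        moreover have "v' - v \<in> vec.span B" using vv' by (simp add: vec.span_diff)
        ultimately have "(a - a') *s b \<in> vec.span B" by simp
        \<comment> \<open>Otherwise scaling by \<open>inverse (a - a')\<close> would put
          \<open>b\<close> into the span of \<open>B\<close>.\<close>
        then have "a = a'"
          using b vec.span_scale[of "(a - a') *s b" B "inverse (a - a')"]
          by (cases "a = a'") (auto simp del: vec.scale_left_diff_distrib vector_ssub_ldistrib vector_sub_rdistrib simp: vector_smult_assoc)
        with eq show "a = a' \<and> v = v'" by simp
      qed
      moreover have "(\<lambda>(a, v). a *s b + v) ` (UNIV \<times> vec.span B) = vec.span (insert b B)"
      proof (intro equalityI subsetI)
        fix x assume "x \<in> vec.span (insert b B)"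
        then obtain a where "x - a *s b \<in> vec.span B" unfolding vec.span_breakdown_eq ..
        then show "x \<in> (\<lambda>(a, v). a *s b + v) ` (UNIV \<times> vec.span B)"
          by (intro image_eqI[of _ _ "(a, x - a *s b)"]) auto
      next
        fix x assume "x \<in> (\<lambda>(a, v). a *s b + v) ` (UNIV \<times> vec.span B)"
        then obtain a v where "x = a *s b + v" and v: "v \<in> vec.span B" by auto
        then have "x - a *s b \<in> vec.span B" by simp
        then show "x \<in> vec.span (insert b B)" unfolding vec.span_breakdown_eq ..
      qed
      ultimately have "bij_betw (\<lambda>(a, v). a *s b + v) (UNIV \<times> vec.span B) (vec.span (insert b B))"
        unfolding bij_betw_def ..
      from bij_betw_same_card[OF this] show ?case
        using insert.IH[OF B] insert.hyps by (simp add: card_cartesian_product)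
    qed simp
  qed
  obtain B where "B \<subseteq> U" "vec.independent B" "U \<subseteq> vec.span B" "card B = vec.dim U"
    using vec.basis_exists by blast
  moreover from this have "vec.span B = U"
    using assms by (intro equalityI vec.span_minimal) auto
  ultimately show ?thesis using span[of B] by simp
qed

text \<open>\<open>u\<close> spans a complement of the section: each \<open>x\<close> in
  \<open>U\<close> is uniquely \<open>a *s u + v\<close> with \<open>v\<close> in the section,
  \<open>a\<close> being the quotient of the scalar products of \<open>c\<close> with
  \<open>x\<close> and \<open>u\<close>.\<close>

lemma card_subspace_perp:
  fixes U :: "('a::{field,finite} ^ 'n) set"
  assumes "vec.subspace U" and "u \<in> U" and "u \<notin> perp c"
  shows "card U = CARD('a) * card (U \<inter> perp c)"
proof -
  have u: "scalar_product c u \<noteq> 0" using assms(3) by (simp add: perp_def)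
  have "inj_on (\<lambda>(a, v). a *s u + v) (UNIV \<times> (U \<inter> perp c))"
  proof (clarsimp simp: inj_on_def)
    fix a v a' v'
    assume vv': "v \<in> perp c" "v' \<in> perp c" and eq: "a *s u + v = a' *s u + v'"
    from arg_cong[OF eq, of "scalar_product c"] have "a = a'"
      using vv' u by (simp add: scalar_product_add_right scalar_product_scale_right perp_def)
    with eq show "a = a' \<and> v = v'" by simp
  qed
  moreover have "(\<lambda>(a, v). a *s u + v) ` (UNIV \<times> (U \<inter> perp c)) = U"
  proof (intro equalityI subsetI)
    fix x assume x: "x \<in> U"
    define a where "a = scalar_product c x / scalar_product c u"
    have "x + (- a) *s u \<in> U \<inter> perp c"
    proof
      show "x + (- a) *s u \<in> U"
        using assms x by (intro vec.subspace_add vec.subspace_scale)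
      show "x + (- a) *s u \<in> perp c"
        unfolding perp_def mem_Collect_eq scalar_product_add_right scalar_product_scale_right
        using u by (simp add: a_def)
    qed
    then show "x \<in> (\<lambda>(a, v). a *s u + v) ` (UNIV \<times> (U \<inter> perp c))"
      by (intro image_eqI[of _ _ "(a, x + (- a) *s u)"]) (auto simp: vec_eq_iff)
  next
    fix x assume "x \<in> (\<lambda>(a, v). a *s u + v) ` (UNIV \<times> (U \<inter> perp c))"
    then obtain a v where "x = a *s u + v" "v \<in> U" by auto
    then show "x \<in> U" using assms by (simp add: vec.subspace_add vec.subspace_scale)
  qed
  ultimately have "bij_betw (\<lambda>(a, v). a *s u + v) (UNIV \<times> (U \<inter> perp c)) U"
    unfolding bij_betw_def ..
  from bij_betw_same_card[OF this] show ?thesis by (simp add: card_cartesian_product)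
qed

text \<open>The drop in dimension is read off from the cardinalities, both powers of
  \<open>CARD('a)\<close>.\<close>

lemma dim_perp_ge:
  fixes U :: "('a::{field,finite} ^ 'n) set"
  assumes "vec.subspace U"
  shows "vec.dim U \<le> vec.dim (U \<inter> perp c) + 1"
proof (cases "U \<subseteq> perp c")
  case True
  then show ?thesis by (simp add: Int_absorb2)
next
  case False
  then have "card U = CARD('a) * card (U \<inter> perp c)"
    using assms card_subspace_perp by blast
  moreover have "vec.subspace (U \<inter> perp c)"
    using assms subspace_perp by (rule vec.subspace_inter)
  ultimately have "CARD('a) ^ vec.dim U = CARD('a) ^ (vec.dim (U \<inter> perp c) + 1)"
    using card_subspace assms by (metis power_add power_one_right mult.commute)
  then have "vec.dim U = vec.dim (U \<inter> perp c) + 1"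
    by (rule power_inject_exp[THEN iffD1, rotated]) (use card_field_ge_2[where 'a='a] in simp)
  then show ?thesis by simp
qed

lemma card_perp:
  fixes v :: "'a::{field,finite} ^ 'n"
  assumes "v \<noteq> 0"
  shows "CARD('a) * card (perp v) = CARD('a) ^ CARD('n)"
proof -
  obtain i where "v $ i \<noteq> 0" using assms by (auto simp: vec_eq_iff)
  then have "axis i 1 \<notin> perp v"
    by (simp add: perp_def scalar_product_commute[of v] scalar_product_axis_left)
  from card_subspace_perp[OF vec.subspace_UNIV _ this] show ?thesis by simp
qed

text \<open>\<open>card_subspace_perp\<close> is applied to \<open>perp v\<close> and the normal
  vector \<open>w\<close>. It needs a vector orthogonal to \<open>v\<close> but not to
  \<open>w\<close>, which exists because \<open>w\<close> is no multiple of
  \<open>v\<close>.\<close>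

lemma card_perp_Int_perp:
  fixes v w :: "'a::{field,finite} ^ 'n"
  assumes "v \<noteq> 0" and "w \<notin> range (\<lambda>a. a *s v)"
  shows "CARD('a)\<^sup>2 * card (perp v \<inter> perp w) = CARD('a) ^ CARD('n)"
proof -
  obtain i where i: "v $ i \<noteq> 0" using assms by (auto simp: vec_eq_iff)
  have "w \<noteq> (w $ i / v $ i) *s v" using assms(2) by blast
  then obtain j where j: "w $ j \<noteq> w $ i / v $ i * v $ j" by (auto simp: vec_eq_iff)
  \<comment> \<open>The correction along axis \<open>i\<close> makes \<open>c\<close> orthogonal to
    \<open>v\<close>; its product with \<open>w\<close> is nonzero by the choice of
    \<open>j\<close>.\<close>
  define c where "c = axis j 1 + (- (v $ j / v $ i)) *s axis i 1"
  have c: "scalar_product x c = x $ j - v $ j / v $ i * x $ i" for x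
    unfolding c_def scalar_product_add_right scalar_product_scale_right
      scalar_product_commute[of x] scalar_product_axis_left by simp
  have "c \<in> perp v" "c \<notin> perp w"
    unfolding perp_def mem_Collect_eq c using i j by (simp_all add: field_simps)
  from card_subspace_perp[OF subspace_perp this] card_perp[OF assms(1)]
  show ?thesis by (simp add: power2_eq_square mult.assoc)
qed

section \<open>First and second moments of the size of a hyperplane section\<close>

lemma card_Int_eq_sum: "finite X \<Longrightarrow> card (X \<inter> Y) = (\<Sum>v\<in>X. if v \<in> Y then 1 else 0)"
  by (simp add: sum.If_cases Collect_conj_eq)

lemma sum_card_Int_perp:
  fixes X :: "('a::{field,finite} ^ 'n) set"
  assumes "0 \<notin> X"
  shows "CARD('a) * (\<Sum>c\<in>UNIV. card (X \<inter> perp c)) = CARD('a) ^ CARD('n) * card X"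
proof -
  have "(\<Sum>c\<in>UNIV. card (X \<inter> perp c)) = (\<Sum>v\<in>X. \<Sum>c\<in>UNIV. if c \<in> perp v then 1 else 0)"
    unfolding card_Int_eq_sum[OF finite] by (subst sum.swap) (simp only: perp_commute)
  also have "\<dots> = (\<Sum>v\<in>X. card (perp v))"
    by (simp add: sum.If_cases)
  finally have "CARD('a) * (\<Sum>c\<in>UNIV. card (X \<inter> perp c)) = (\<Sum>v\<in>X. CARD('a) * card (perp v))"
    by (simp add: sum_distrib_left)
  also have "\<dots> = (\<Sum>v\<in>X. CARD('a) ^ CARD('n))"
    using assms by (intro sum.cong refl card_perp) auto
  finally show ?thesis by simp
qed

lemma card_range_scale:
  fixes v :: "'a::{field,finite} ^ 'n"
  assumes "v \<noteq> 0"
  shows "card ((\<lambda>a. a *s v) ` (- {0})) = CARD('a) - 1"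
proof -
  have "inj_on (\<lambda>a. a *s v) (- {0})"
    using assms by (auto simp: inj_on_def vec.scale_cancel_right)
  then show ?thesis by (simp add: card_image Compl_eq_Diff_UNIV card_Diff_singleton)
qed

text \<open>Counts triples \<open>c\<close>, \<open>v\<close>, \<open>w\<close> with
  \<open>v\<close> and \<open>w\<close> both orthogonal to \<open>c\<close>. For fixed
  \<open>v\<close>, the \<open>CARD('a) - 1\<close> nonzero multiples \<open>w\<close> of
  \<open>v\<close> all lie in \<open>X\<close> and impose no new condition on \<open>c\<close>;
  every other \<open>w\<close> imposes an independent one. The term added on the left avoids a
  subtraction of naturals.\<close>

lemma sum_card_Int_perp_sq:
  fixes X :: "('a::{field,finite} ^ 'n) set"
  assumes X0: "0 \<notin> X" and scale: "\<And>a v. v \<in> X \<Longrightarrow> a \<noteq> 0 \<Longrightarrow> a *s v \<in> X"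
  shows "CARD('a)\<^sup>2 * (\<Sum>c\<in>UNIV. (card (X \<inter> perp c))\<^sup>2) + CARD('a) ^ CARD('n) * card X * (CARD('a) - 1)
     = CARD('a) ^ CARD('n) * card X * (CARD('a) * (CARD('a) - 1) + card X)"
proof -
  let ?q = "CARD('a)" let ?D = "CARD('a) ^ CARD('n)"
  have "(\<Sum>c\<in>UNIV. (card (X \<inter> perp c))\<^sup>2) =
      (\<Sum>c\<in>UNIV. \<Sum>v\<in>X. \<Sum>w\<in>X. if c \<in> perp v \<inter> perp w then 1 else 0)"
    unfolding card_Int_eq_sum[OF finite] power2_eq_square sum_product
    by (intro sum.cong) (auto simp: perp_def scalar_product_commute)
  also have "\<dots> = (\<Sum>v\<in>X. \<Sum>w\<in>X. card (perp v \<inter> perp w))"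
    unfolding sum.swap[of _ X UNIV]
    by (simp add: sum.If_cases Collect_conj_eq)
  finally have 1: "(\<Sum>c\<in>UNIV. (card (X \<inter> perp c))\<^sup>2) = (\<Sum>v\<in>X. \<Sum>w\<in>X. card (perp v \<inter> perp w))" .
  have 2: "?q\<^sup>2 * (\<Sum>w\<in>X. card (perp v \<inter> perp w)) + ?D * (?q - 1) = ?D * (?q * (?q - 1) + card X)"
    if v: "v \<in> X" for v
  proof -
    have v0: "v \<noteq> 0" using v X0 by auto
    let ?L = "(\<lambda>a. a *s v) ` (- {0})"
    have L: "?L \<subseteq> X" using v scale by auto
    have "?q\<^sup>2 * card (perp v \<inter> perp w) = ?q * ?D" if "w \<in> ?L" for w
    proof -
      have "perp w = perp v"
      proof -
        obtain a where "a \<noteq> 0" "w = a *s v" using \<open>w \<in> ?L\<close> by auto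
        then have "x \<in> perp w \<longleftrightarrow> x \<in> perp v" for x
          unfolding perp_commute[of x] by (simp add: perp_def scalar_product_scale_right)
        then show ?thesis by blast
      qed
      then show ?thesis using card_perp[OF v0] by (simp add: power2_eq_square)
    qed
    then have sL: "(\<Sum>w\<in>?L. ?q\<^sup>2 * card (perp v \<inter> perp w)) = (?q - 1) * (?q * ?D)"
      using card_range_scale[OF v0] by simp
    have "?q\<^sup>2 * card (perp v \<inter> perp w) = ?D" if "w \<in> X - ?L" for w
    proof (rule card_perp_Int_perp[OF v0])
      show "w \<notin> range (\<lambda>a. a *s v)" using that X0 by (cases "w = 0") auto
    qed
    then have "(\<Sum>w\<in>X - ?L. ?q\<^sup>2 * card (perp v \<inter> perp w)) = card (X - ?L) * ?D"
      by simp
    moreover have "card X * ?D = card (X - ?L) * ?D + (?q - 1) * ?D"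
      using L card_range_scale[OF v0] card_mono[OF _ L]
      by (simp add: card_Diff_subset flip: add_mult_distrib)
    moreover have "(\<Sum>w\<in>X. ?q\<^sup>2 * card (perp v \<inter> perp w)) =
        (\<Sum>w\<in>X - ?L. ?q\<^sup>2 * card (perp v \<inter> perp w)) + (\<Sum>w\<in>?L. ?q\<^sup>2 * card (perp v \<inter> perp w))"
      by (rule sum.subset_diff[OF L]) simp
    ultimately have "(\<Sum>w\<in>X. ?q\<^sup>2 * card (perp v \<inter> perp w)) + (?q - 1) * ?D
        = card X * ?D + (?q - 1) * (?q * ?D)"
      using sL by simp
    then show ?thesis by (simp add: sum_distrib_left algebra_simps)
  qed
  have "?q\<^sup>2 * (\<Sum>v\<in>X. \<Sum>w\<in>X. card (perp v \<inter> perp w)) + ?D * card X * (?q - 1)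
      = (\<Sum>v\<in>X. ?q\<^sup>2 * (\<Sum>w\<in>X. card (perp v \<inter> perp w)) + ?D * (?q - 1))"
    by (simp add: sum_distrib_left sum.distrib)
  also have "\<dots> = (\<Sum>v\<in>X. ?D * (?q * (?q - 1) + card X))"
    using 2 by (rule sum.cong[OF refl])
  finally show ?thesis unfolding 1 by simp
qed

text \<open>The \<open>insert 0\<close> keeps the zero vector from being a hole when
  \<open>S\<close> is empty.\<close>

definition holes :: "('a::field ^ 'n) set set \<Rightarrow> ('a ^ 'n) set" where
  "holes S = - insert 0 (\<Union>S)"

lemma holes_scale:
  assumes S: "partial_spread t S" and v: "v \<in> holes S" and a: "a \<noteq> 0"
  shows "a *s v \<in> holes S"
proof -
  have "v \<in> W" if "W \<in> S" "a *s v \<in> W" for W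
  proof -
    have "inverse a *s (a *s v) \<in> W"
      using S that vec.subspace_scale unfolding partial_spread_def by blast
    then show ?thesis using a by (simp add: vector_smult_assoc)
  qed
  then show ?thesis using v a by (auto simp: holes_def)
qed

section \<open>The number of holes in a subspace and its residue class\<close>

lemma card_holes_Int:
  fixes S :: "('a::{field,finite} ^ 'n) set set"
  assumes S: "partial_spread t S" and U: "vec.subspace U"
  shows "int (card (holes S \<inter> U)) = int (card U) - 1 - (\<Sum>W\<in>S. int (card (U \<inter> W)) - 1)"
proof -
  have 0: "0 \<in> U \<inter> W" if "W \<in> S" for W
    using S U that by (auto simp: partial_spread_def vec.subspace_0)
  have "(U \<inter> V - {0}) \<inter> (U \<inter> W - {0}) = {}" if "V \<in> S" "W \<in> S" "V \<noteq> W" for V W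
    using S that by (auto simp: partial_spread_def)
  then have "card (\<Union>W\<in>S. U \<inter> W - {0}) = (\<Sum>W\<in>S. card (U \<inter> W - {0}))"
    by (intro card_UN_disjoint) auto
  then have "int (card (\<Union>W\<in>S. U \<inter> W - {0})) = (\<Sum>W\<in>S. int (card (U \<inter> W - {0})))"
    by simp
  also have "\<dots> = (\<Sum>W\<in>S. int (card (U \<inter> W)) - 1)"
  proof (rule sum.cong)
    fix W assume "W \<in> S"
    then have "card (U \<inter> W) = Suc (card (U \<inter> W - {0}))"
      using 0 by (metis card_Suc_Diff1 finite)
    then show "int (card (U \<inter> W - {0})) = int (card (U \<inter> W)) - 1" by simp
  qed simp
  finally have 1: "int (card (\<Union>W\<in>S. U \<inter> W - {0})) = (\<Sum>W\<in>S. int (card (U \<inter> W)) - 1)" .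
  have "0 \<in> U" using U by (rule vec.subspace_0)
  then have "U = insert 0 ((holes S \<inter> U) \<union> (\<Union>W\<in>S. U \<inter> W - {0}))"
    by (auto simp: holes_def)
  moreover have "card (insert 0 ((holes S \<inter> U) \<union> (\<Union>W\<in>S. U \<inter> W - {0})))
      = Suc (card (holes S \<inter> U) + card (\<Union>W\<in>S. U \<inter> W - {0}))"
    by (subst card_insert_disjoint, simp, simp add: holes_def, subst card_Un_disjoint)
       (auto simp: holes_def)
  ultimately have "card U = Suc (card (holes S \<inter> U) + card (\<Union>W\<in>S. U \<inter> W - {0}))" by metis
  then show ?thesis using 1 by simp
qed

text \<open>
  Intersecting \<open>t - k\<close> hyperplanes gives a \<open>k\<close>-deep subspace if \<open>S\<close> is a partial spread of
  \<open>t\<close>-dimensional subspaces.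
\<close>
definition deep :: "('a::field ^ 'n) set set \<Rightarrow> nat \<Rightarrow> ('a ^ 'n) set \<Rightarrow> bool" where
  "deep S k U \<longleftrightarrow> vec.subspace U \<and> k \<le> vec.dim U \<and> (\<forall>W\<in>S. k \<le> vec.dim (U \<inter> W))"

lemma deep_Int_perp:
  fixes S :: "('a::{field,finite} ^ 'n) set set"
  assumes S: "partial_spread t S" and U: "deep S (Suc k) U"
  shows "deep S k (U \<inter> perp c)"
  unfolding deep_def
proof (intro conjI ballI)
  have sU: "vec.subspace U" using U by (simp add: deep_def)
  then show "vec.subspace (U \<inter> perp c)" by (simp add: vec.subspace_inter subspace_perp)
  show "k \<le> vec.dim (U \<inter> perp c)"
    using U dim_perp_ge[OF sU, of c] by (simp add: deep_def)
  fix W assume W: "W \<in> S"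
  then have "vec.subspace (U \<inter> W)"
    using S sU by (simp add: partial_spread_def vec.subspace_inter)
  from dim_perp_ge[OF this, of c] show "k \<le> vec.dim (U \<inter> perp c \<inter> W)"
    using U W by (auto simp: deep_def Int_ac)
qed

text \<open>With \<open>b\<close> a dimension, this makes the sizes of all subspaces of dimension at
  least \<open>k\<close> congruent to \<open>q ^ k\<close> modulo
  \<open>(q - 1) * q ^ k\<close>.\<close>

lemma minus_one_times_power_dvd_power_diff:
  fixes q :: int
  assumes "k \<le> b"
  shows "(q - 1) * q ^ k dvd q ^ b - q ^ k"
proof -
  have "q ^ b - q ^ k = (q ^ (b - k) - 1) * q ^ k"
    using assms by (simp add: left_diff_distrib flip: power_add)
  moreover have "q - 1 dvd q ^ (b - k) - 1"
    using power_diff_1_eq[of q "b - k"] by simp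
  ultimately show ?thesis by (simp add: mult_dvd_mono)
qed

text \<open>Modulo \<open>(q - 1) * q ^ k\<close>, both \<open>U\<close> and every
  \<open>U \<inter> W\<close> count as \<open>q ^ k\<close>, so the number of holes is congruent to
  \<open>(1 - card S) * (q ^ k - 1)\<close>. The prescribed size of \<open>S\<close> is one more
  than Kurz's bound.\<close>

lemma card_holes_cong:
  fixes S :: "('a::{field,finite} ^ 'n) set set" and z L :: nat
  assumes S: "partial_spread t S" and U: "deep S k U" and k: "k \<le> t"
    and card: "card S = L * CARD('a) ^ t + 2 + z * (CARD('a) - 1)"
    and q: "q = int CARD('a)"
  obtains m where "int (card (holes S \<inter> U)) = (q - 1) * m * q ^ k - q ^ k + 1 + (q - 1) * int z"
proof -
  have sU: "vec.subspace U" using U by (simp add: deep_def)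
  have cU: "int (card U) = q ^ vec.dim U" using card_subspace[OF sU] q by simp
  have cW: "int (card (U \<inter> W)) = q ^ vec.dim (U \<inter> W)" if "W \<in> S" for W
    using card_subspace[of "U \<inter> W"] q that S sU by (simp add: partial_spread_def vec.subspace_inter)
  have q2: "2 \<le> q" using card_field_ge_2[where 'a='a] q by linarith
  have cS: "int (card S) = int L * q ^ t + 2 + int z * (q - 1)"
    using card q2 q by (simp add: of_nat_diff)
  define E where "E = (\<Sum>W\<in>S. int (card (U \<inter> W)) - q ^ k)"
  have "(\<Sum>W\<in>S. int (card (U \<inter> W)) - 1) = E + int (card S) * (q ^ k - 1)"
    unfolding E_def by (simp add: sum_subtractf algebra_simps)
  then have "int (card (holes S \<inter> U)) - (1 - q ^ k + (q - 1) * int z)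
     = (int (card U) - q ^ k) - E - (int L * (q ^ t * (q ^ k - 1)) + int z * ((q - 1) * q ^ k))"
    unfolding card_holes_Int[OF S sU] cS by (simp add: algebra_simps)
  moreover have "(q - 1) * q ^ k dvd E"
    unfolding E_def using U cW by (intro dvd_sum) (auto simp: deep_def intro!: minus_one_times_power_dvd_power_diff)
  moreover have "(q - 1) * q ^ k dvd int (card U) - q ^ k"
    unfolding cU using U by (intro minus_one_times_power_dvd_power_diff) (simp add: deep_def)
  \<comment> \<open>Here \<open>k \<le> t\<close> enters: \<open>q ^ t\<close> supplies
    \<open>q ^ k\<close>, and \<open>q ^ k - 1\<close> supplies \<open>q - 1\<close>. This removes
    the contribution of \<open>L\<close>.\<close>
  moreover have "(q - 1) * q ^ k dvd q ^ t * (q ^ k - 1)"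
    using mult_dvd_mono[OF le_imp_power_dvd[OF k, of q] minus_one_times_power_dvd_power_diff[of 0 k q]]
    by (simp add: mult.commute)
  ultimately have "(q - 1) * q ^ k dvd int (card (holes S \<inter> U)) - (1 - q ^ k + (q - 1) * int z)"
    by (metis dvd_add dvd_diff dvd_mult dvd_triv_right)
  then obtain m where "int (card (holes S \<inter> U)) - (1 - q ^ k + (q - 1) * int z) = (q - 1) * q ^ k * m" ..
  then have "int (card (holes S \<inter> U)) = (q - 1) * m * q ^ k - q ^ k + 1 + (q - 1) * int z"
    by (simp add: algebra_simps)
  then show ?thesis by (rule that)
qed

section \<open>Descent through hyperplane sections with few holes\<close>

lemma ex_perp_card_le:
  fixes X :: "('a::{field,finite} ^ 'n) set"
  assumes "0 \<notin> X"
  obtains c where "CARD('a) * card (X \<inter> perp c) \<le> card X"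
proof (rule ccontr)
  assume "\<not> thesis"
  then have less: "card X < CARD('a) * card (X \<inter> perp c)" for c
    using that not_le by blast
  have "(\<Sum>c\<in>(UNIV :: ('a ^ 'n) set). card X) < (\<Sum>c\<in>UNIV. CARD('a) * card (X \<inter> perp c))"
    by (rule sum_strict_mono) (use less in auto)
  then show False
    using sum_card_Int_perp[OF assms] by (simp add: sum_distrib_left)
qed

lemma ex_perp_fewer_holes:
  fixes S :: "('a::{field,finite} ^ 'n) set set" and z L :: nat
  assumes S: "partial_spread t S" and U: "deep S (Suc k) U" and k: "Suc k \<le> t"
    and card: "card S = L * CARD('a) ^ t + 2 + z * (CARD('a) - 1)"
    and q: "q = int CARD('a)"
    and x: "int (card (holes S \<inter> U)) = (q - 1) * m * q ^ Suc k - q ^ Suc k + 1 + (q - 1) * int z"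
  obtains U' m' where "deep S k U'" "m' < m"
    "int (card (holes S \<inter> U')) = (q - 1) * m' * q ^ k - q ^ k + 1 + (q - 1) * int z"
proof -
  have q2: "2 \<le> q" using card_field_ge_2[where 'a='a] q by linarith
  obtain c where c: "CARD('a) * card (holes S \<inter> U \<inter> perp c) \<le> card (holes S \<inter> U)"
    using ex_perp_card_le[of "holes S \<inter> U"] by (auto simp: holes_def)
  have d: "deep S k (U \<inter> perp c)" using deep_Int_perp[OF S U] .
  obtain m' where m': "int (card (holes S \<inter> (U \<inter> perp c)))
      = (q - 1) * m' * q ^ k - q ^ k + 1 + (q - 1) * int z"
    using card_holes_cong[OF S d _ card q] k by auto
  have "q * int (card (holes S \<inter> (U \<inter> perp c))) \<le> int (card (holes S \<inter> U))"
    using c unfolding q Int_assoc by (simp flip: of_nat_mult)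
  \<comment> \<open>The terms \<open>q ^ Suc k\<close> cancel, and the constants leave
    \<open>(1 - q) * (1 + (q - 1) * z)\<close>. This is negative, so the descent is strict.\<close>
  then have "(q - 1) * (q ^ Suc k * (m' - m)) \<le> (q - 1) * (- 1 - (q - 1) * int z)"
    unfolding m' x by (simp add: algebra_simps)
  then have "q ^ Suc k * (m' - m) \<le> - 1 - (q - 1) * int z"
    using q2 by (simp only: mult_le_cancel_left)
  also have "\<dots> < 0" using q2 by (smt (verit) mult_nonneg_nonneg of_nat_0_le_iff)
  finally have "m' < m" using q2 by (simp add: mult_less_0_iff)
  with d m' show ?thesis by (intro that)
qed

lemma ex_deep_few_holes:
  fixes S :: "('a::{field,finite} ^ 'n) set set" and z L :: nat
  assumes S: "partial_spread t S"
    and card: "card S = L * CARD('a) ^ t + 2 + z * (CARD('a) - 1)"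
    and q: "q = int CARD('a)"
    and U0: "deep S t U0" 
      "int (card (holes S \<inter> U0)) = (q - 1) * m0 * q ^ t - q ^ t + 1 + (q - 1) * int z"
    and "k \<le> t"
  shows "\<exists>U m. deep S k U \<and> m \<le> m0 - int (t - k) \<and>
    int (card (holes S \<inter> U)) = (q - 1) * m * q ^ k - q ^ k + 1 + (q - 1) * int z"
  using \<open>k \<le> t\<close>
proof (induction k rule: inc_induct)
  case base
  then show ?case using U0 by auto
next
  case (step k)
  then obtain U m where U: "deep S (Suc k) U" "m \<le> m0 - int (t - Suc k)"
    "int (card (holes S \<inter> U)) = (q - 1) * m * q ^ Suc k - q ^ Suc k + 1 + (q - 1) * int z"
    by blast
  from step have "Suc k \<le> t" by simp
  from ex_perp_fewer_holes[OF S U(1) this card q U(3)] obtain U' m' where "deep S k U'" "m' < m"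
    "int (card (holes S \<inter> U')) = (q - 1) * m' * q ^ k - q ^ k + 1 + (q - 1) * int z" .
  then show ?case using U(2) step by (intro exI[of _ U'] exI[of _ m']) auto
qed

text \<open>The numerical fact that contradicts the second-moment inequality at
  \<open>k = Suc z\<close>.\<close>

lemma quadratic_less_power:
  fixes q :: int and z :: nat
  assumes "2 \<le> q"
  shows "(1 + (q - 1) * int z) * (2 + (q - 1) * int z) < 2 * q ^ Suc z"
proof (induction z)
  case 0
  then show ?case using assms by simp
next
  case (Suc z)
  define p where "p = q - 1"
  have p: "1 \<le> p" "q = p + 1" using assms by (auto simp: p_def)
  show ?case
  proof (cases "z = 0")
    case True
    have "0 < p * (1 + p)" using p by simp
    then have "(1 + p) * (2 + p) < 2 * ((1 + p) * (1 + p))" by (simp add: algebra_simps)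
    then show ?thesis using True p by (simp add: algebra_simps)
  next
    \<comment> \<open>Passing to \<open>Suc z\<close> replaces \<open>v\<close> by
      \<open>v + p\<close>, which multiplies \<open>v * (v + 1)\<close> by at most \<open>q\<close>
      as soon as \<open>p + 1 \<le> v * (v - 1)\<close>. This fails for \<open>v = 1\<close>, hence
      the separate case \<open>z = 0\<close>.\<close>
    case False
    define v where "v = 1 + p * int z"
    have "p * 1 \<le> p * int z" using False p by (intro mult_left_mono) auto
    then have v: "p + 1 \<le> v" by (simp add: v_def)
    have "(p + 1) * 1 \<le> v * (v - 1)" using v p by (intro mult_mono) auto
    then have "p * (2 * v + p + 1) \<le> p * (v * (v + 1))"
      using p by (intro mult_left_mono) (auto simp: algebra_simps)
    then have "(v + p) * (v + p + 1) \<le> q * (v * (v + 1))"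
      using p by (simp add: algebra_simps)
    also have "\<dots> < q * (2 * q ^ Suc z)"
      using Suc p by (intro mult_strict_left_mono) (auto simp: v_def algebra_simps)
    finally show ?thesis unfolding v_def using p by (simp add: algebra_simps)
  qed
qed

text \<open>Summing \<open>(xc c - A) * (xc c - B) \<ge> 0\<close> over all \<open>c\<close> and
  inserting both moments gives a lower bound on \<open>v * (v + 1)\<close> that contradicts
  \<open>quadratic_less_power\<close>.\<close>

lemma no_deep_few_holes:
  fixes S :: "('a::{field,finite} ^ 'n) set set" and z L :: nat
  assumes S: "partial_spread t S"
    and card: "card S = L * CARD('a) ^ t + 2 + z * (CARD('a) - 1)"
    and q: "q = int CARD('a)"
    and U: "deep S (Suc z) U" and z: "Suc z \<le> t" and m: "m \<le> int z"
    and x: "int (card (holes S \<inter> U)) = (q - 1) * m * q ^ Suc z - q ^ Suc z + 1 + (q - 1) * int z"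
  shows False
proof -
  have q2: "2 \<le> q" using card_field_ge_2[where 'a='a] q by linarith
  define p where "p = q - 1"
  define y where "y = q ^ z"
  define v where "v = 1 + p * int z"
  define x where "x = int (card (holes S \<inter> U))"
  define xc where "xc = (\<lambda>c. int (card (holes S \<inter> U \<inter> perp c)))"
  define D where "D = q ^ CARD('n)"
  \<comment> \<open>Consecutive members of the residue class of all the \<open>xc c\<close>, so none lies strictly between.\<close>
  define A where "A = p * (m - 1) * y - y + v"
  define B where "B = p * m * y - y + v"
  have nonneg: "0 \<le> (xc c - A) * (xc c - B)" for c
  proof -
    have d: "deep S z (U \<inter> perp c)" using deep_Int_perp[OF S U] .
    obtain m' where m': "int (card (holes S \<inter> (U \<inter> perp c)))
        = (q - 1) * m' * q ^ z - q ^ z + 1 + (q - 1) * int z"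
      using card_holes_cong[OF S d _ card q] z by auto
    then have "xc c - A = p * y * (m' - m + 1)" "xc c - B = p * y * (m' - m)"
      by (simp_all add: xc_def Int_assoc A_def B_def p_def y_def v_def algebra_simps)
    then have "(xc c - A) * (xc c - B) = (p * y)\<^sup>2 * ((m' - m + 1) * (m' - m))"
      by (simp only: power2_eq_square mult_ac)
    moreover have "0 \<le> (m' - m + 1) * (m' - m)"
      by (cases "m' - m \<ge> 0") (auto intro: mult_nonneg_nonneg mult_nonpos_nonpos)
    ultimately show ?thesis by simp
  qed
  have X0: "0 \<notin> holes S \<inter> U" by (simp add: holes_def)
  have Xs: "a *s w \<in> holes S \<inter> U" if "w \<in> holes S \<inter> U" "a \<noteq> 0" for a w
    using that holes_scale[OF S] U by (auto simp: deep_def vec.subspace_scale)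
  have s1: "q * (\<Sum>c\<in>UNIV. xc c) = D * x"
    using arg_cong[OF sum_card_Int_perp[OF X0], of int]
    by (simp add: xc_def x_def D_def q)
  have s2: "q\<^sup>2 * (\<Sum>c\<in>UNIV. (xc c)\<^sup>2) + D * x * p = D * x * (q * p + x)"
    using arg_cong[OF sum_card_Int_perp_sq[OF X0 Xs], of int]
    by (simp add: xc_def x_def D_def p_def q of_nat_diff)
  have "(\<Sum>c\<in>UNIV. (xc c - A) * (xc c - B)) = (\<Sum>c\<in>UNIV. (xc c)\<^sup>2 - (A + B) * xc c + A * B)"
    by (simp add: power2_eq_square algebra_simps)
  also have "\<dots> = (\<Sum>c\<in>UNIV. (xc c)\<^sup>2) - (A + B) * (\<Sum>c\<in>UNIV. xc c) + D * (A * B)"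
    by (simp add: sum.distrib sum_subtractf sum_distrib_left D_def q)
  finally have sum: "(\<Sum>c\<in>UNIV. (xc c - A) * (xc c - B))
      = (\<Sum>c\<in>UNIV. (xc c)\<^sup>2) - (A + B) * (\<Sum>c\<in>UNIV. xc c) + D * (A * B)" .
  have "q\<^sup>2 * (\<Sum>c\<in>UNIV. (xc c - A) * (xc c - B))
      = q\<^sup>2 * (\<Sum>c\<in>UNIV. (xc c)\<^sup>2) - (A + B) * q * (q * (\<Sum>c\<in>UNIV. xc c)) + q\<^sup>2 * D * (A * B)"
    unfolding sum by (simp add: algebra_simps power2_eq_square)
  also have "\<dots> = D * ((x - q * A) * (x - q * B) + p\<^sup>2 * x)"
    using s2 unfolding s1 p_def by (simp add: algebra_simps power2_eq_square)
  finally have "0 \<le> D * ((x - q * A) * (x - q * B) + p\<^sup>2 * x)"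
    using nonneg by (metis (no_types, lifting) mult_nonneg_nonneg sum_nonneg zero_le_power2)
  moreover have "0 < D" using q2 by (simp add: D_def)
  ultimately have "0 \<le> (x - q * A) * (x - q * B) + p\<^sup>2 * x"
    by (simp add: zero_le_mult_iff)
  \<comment> \<open>The factors are \<open>x - q * A = p * (q * y - v)\<close> and
    \<open>x - q * B = - p * v\<close>.\<close>
  also have "(x - q * A) * (x - q * B) + p\<^sup>2 * x = p\<^sup>2 * (v * (v + 1) - q * y * (v + 1 - p * m))"
  proof -
    have "x = p * m * (q * y) - q * y + v"
      using x unfolding x_def p_def y_def v_def by simp
    then show ?thesis
      unfolding A_def B_def p_def by (simp only:) (simp add: algebra_simps power2_eq_square)
  qed
  finally have "q * y * (v + 1 - p * m) \<le> v * (v + 1)"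
    using q2 by (simp add: p_def zero_le_mult_iff)
  \<comment> \<open>This is where \<open>m \<le> z\<close> is needed: it makes the factor
    \<open>v + 1 - p * m\<close> at least \<open>2\<close>.\<close>
  moreover have "2 * (q * y) \<le> q * y * (v + 1 - p * m)"
  proof -
    have "p * m \<le> p * int z" using q2 m by (intro mult_left_mono) (auto simp: p_def)
    then have "(q * y) * 2 \<le> (q * y) * (v + 1 - p * m)"
      using q2 by (intro mult_left_mono) (auto simp: v_def y_def)
    then show ?thesis by simp
  qed
  moreover have "v * (v + 1) < 2 * (q * y)"
    using quadratic_less_power[OF q2, of z] by (simp add: v_def p_def y_def algebra_simps)
  ultimately show False by linarith
qed

text \<open>Kurz's bound. With \<open>q = CARD('a)\<close>, the first \<open>L\<close> assumption
  makes \<open>L * q ^ t\<close> the quotient of \<open>q ^ n - q ^ (t + r)\<close> by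
  \<open>q ^ t - 1\<close>, and the assumption \<open>r\<close> says
  \<open>theta q r = t - 1 + z\<close>.\<close>

lemma card_partial_spread_le:
  fixes S :: "('a::{field,finite} ^ 'n) set set" and z L :: nat
  assumes S: "partial_spread t S" and t: "t \<le> CARD('n)" and z: "Suc z \<le> t"
    and L: "L * CARD('a) ^ t * (CARD('a) ^ t - 1) = CARD('a) ^ CARD('n) - CARD('a) ^ (t + r)"
      "CARD('a) ^ (t + r) \<le> CARD('a) ^ CARD('n)"
    and r: "CARD('a) ^ r - 1 = (CARD('a) - 1) * (t - 1 + z)"
  shows "card S \<le> L * CARD('a) ^ t + 1 + z * (CARD('a) - 1)"
proof (rule ccontr)
  assume "\<not> ?thesis"
  then have "L * CARD('a) ^ t + 2 + z * (CARD('a) - 1) \<le> card S" by simp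
  then obtain T where "T \<subseteq> S" and card: "card T = L * CARD('a) ^ t + 2 + z * (CARD('a) - 1)"
    using obtain_subset_with_card_n by metis
  then have T: "partial_spread t T" using S unfolding partial_spread_def by blast
  define q where "q = int CARD('a)"
  have q2: "2 \<le> q" using card_field_ge_2[where 'a='a] q_def by linarith
  have cT: "int (card T) = int L * q ^ t + 2 + int z * (q - 1)"
    using card q2 q_def by (simp add: of_nat_diff)
  have d: "deep T t UNIV" 
  proof -
    have "t \<le> vec.dim (UNIV :: ('a ^ 'n) set)" using t by (simp only: vec_dim_card)
    then show ?thesis using T by (simp add: deep_def partial_spread_def)
  qed
  have L': "int L * q ^ t * (q ^ t - 1) = q ^ CARD('n) - q ^ (t + r)"
    using arg_cong[OF L(1), of int] L(2) unfolding q_def by (simp add: of_nat_diff)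
  have r': "q ^ r = 1 + (q - 1) * (int t - 1 + int z)"
  proof -
    have "int (CARD('a) ^ r - 1) = q ^ r - 1" "int (CARD('a) - 1) = q - 1"
      using q2 by (simp_all add: of_nat_diff q_def)
    moreover have "int (t - 1 + z) = int t - 1 + int z" using z by (simp add: of_nat_diff)
    ultimately have "q ^ r - 1 = (q - 1) * (int t - 1 + int z)"
      using r by (metis of_nat_mult)
    then show ?thesis by linarith
  qed
  have "int (card W) = q ^ t" if "W \<in> T" for W
    using card_subspace[of W] T that by (simp add: partial_spread_def q_def)
  then have "int (card (holes T \<inter> UNIV)) = q ^ CARD('n) - 1 - int (card T) * (q ^ t - 1)"
    unfolding card_holes_Int[OF T vec.subspace_UNIV] by (simp add: q_def)
  also have "\<dots> = q ^ t * q ^ r - 1 - (2 + int z * (q - 1)) * (q ^ t - 1)"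
    using L' unfolding cT by (simp add: algebra_simps power_add)
  \<comment> \<open>The multiples \<open>z * (q - 1) * q ^ t\<close> cancel, so the descent starts
    from \<open>t - 1\<close>.\<close>
  also have "\<dots> = (q - 1) * (int t - 1) * q ^ t - q ^ t + 1 + (q - 1) * int z"
    unfolding r' by (simp add: algebra_simps)
  finally have x: "int (card (holes T \<inter> UNIV)) = (q - 1) * (int t - 1) * q ^ t - q ^ t + 1 + (q - 1) * int z" .
  from ex_deep_few_holes[OF T card q_def d x z] obtain U m where U: "deep T (Suc z) U"
    "m \<le> int t - 1 - int (t - Suc z)"
    "int (card (holes T \<inter> U)) = (q - 1) * m * q ^ Suc z - q ^ Suc z + 1 + (q - 1) * int z"
    by blast
  have "m \<le> int z" using U(2) z by simp
  from no_deep_few_holes[OF T card q_def U(1) z this U(3)] show False .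
qed

section \<open>Estimates for \<open>theta\<close> and \<open>omega\<close>, and the difference of
  the two bounds\<close>

lemma ex_theta_eq_of_nat:
  assumes "2 \<le> q"
  obtains N where "theta q i = real N" "q ^ i - 1 = (q - 1) * N"
proof -
  have "q - 1 dvd q ^ i - 1"
    using power_diff_1_eq[of "int q" i] assms
    by (simp add: of_nat_diff flip: int_dvd_int_iff)
  then obtain N where N: "q ^ i - 1 = (q - 1) * N" ..
  have "real q ^ i - 1 = real (q ^ i - 1)" using assms by (simp add: of_nat_diff)
  also have "\<dots> = (real q - 1) * real N" unfolding N using assms by (simp add: of_nat_diff)
  finally have "theta q i = real N" using assms by (simp add: theta_def)
  then show ?thesis using N by (rule that)
qed

lemma theta_times: "2 \<le> q \<Longrightarrow> (real q - 1) * theta q i = real q ^ i - 1"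
  by (simp add: theta_def)

text \<open>Put \<open>a = q ^ t\<close> and \<open>b = q ^ r\<close>. The radicand is
  \<open>(2 * a - b)\<^sup>2 - b\<^sup>2 + 1\<close>, and \<open>b\<^sup>2 \<le> a\<close> follows
  from \<open>2 * r \<le> t\<close>; so the root lies in the unit interval just below
  \<open>2 * a - b\<close>, and \<open>2 * omega\<close> in \<open>[b - 2, b - 1)\<close>.\<close>

lemma floor_omega:
  assumes q: "2 \<le> q" and r: "1 \<le> r" and t: "2 * r \<le> t"
  shows "\<lfloor>omega q t r\<rfloor> = \<lfloor>real q ^ r / 2\<rfloor> - 1"
proof -
  define a where "a = real q ^ t"
  define b where "b = real q ^ r"
  have b1: "2 \<le> b"
  proof -
    have "real q ^ 1 \<le> b" unfolding b_def using q r by (intro power_increasing) auto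
    then show ?thesis using q by simp
  qed
  have "b\<^sup>2 \<le> a"
    unfolding a_def b_def using q t by (simp flip: power_mult add: power_increasing mult.commute)
  then have ab: "b * b \<le> a" by (simp add: power2_eq_square)
  have bb: "2 * b \<le> b * b" using b1 by (intro mult_right_mono) auto
  have b4: "b * b + 2 * b \<le> 4 * a" "1 < b * b" "0 \<le> 2 * a - b"
    using ab bb b1 by linarith+
  define R where "R = sqrt (4 * a * (a - b) + 1)"
  have "2 * a - b - 1 \<le> R"
    unfolding R_def by (rule real_le_rsqrt) (use b4(1) in \<open>simp add: power2_eq_square algebra_simps\<close>)
  moreover have "R < 2 * a - b"
  proof -
    have "4 * a * (a - b) + 1 < (2 * a - b)\<^sup>2"
      using b4(2) by (simp add: power2_eq_square algebra_simps)
    then show ?thesis unfolding R_def using b4(3) by (intro real_less_lsqrt) auto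
  qed
  ultimately have "b - 2 \<le> 2 * omega q t r" "2 * omega q t r < b - 1"
    by (simp_all add: omega_def R_def a_def b_def)
  \<comment> \<open>For either parity of \<open>q ^ r\<close>, that interval gives
    \<open>e - 1 \<le> omega < e\<close>.\<close>
  moreover define e where "e = q ^ r div 2"
  moreover have "b = 2 * real e \<or> b = 2 * real e + 1"
  proof -
    have "q ^ r = 2 * e \<or> q ^ r = 2 * e + 1" unfolding e_def by presburger
    then have "real (q ^ r) = real (2 * e) \<or> real (q ^ r) = real (2 * e + 1)" by (simp only: of_nat_eq_iff)
    then show ?thesis by (auto simp: b_def)
  qed
  ultimately have "\<lfloor>omega q t r\<rfloor> = int e - 1" by (auto intro!: floor_unique)
  moreover have "\<lfloor>b / 2\<rfloor> = int e"
    using floor_divide_of_nat_eq[of "q ^ r" 2, where 'a = real] by (simp add: b_def e_def)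
  ultimately show ?thesis by (simp add: b_def)
qed

lemma g_bound_minus_f_bound:
  assumes "2 \<le> q" and "1 \<le> r" and "2 * r \<le> t" and "n mod t = r"
  shows "g_bound q n t - f_bound q n t =
    of_int \<lfloor>real q ^ r / 2\<rfloor> - (real q - 1) * (real t - 2) - of_int (c1 q t) + of_int (c2 q t)"
  using assms by (simp add: g_bound_def f_bound_def floor_omega)

lemma four_times_le_two_power: "4 * s \<le> 2 ^ s + (4 :: nat)"
proof (induction s)
  case (Suc s)
  show ?case
  proof (cases "s < 2")
    case True
    then have "s = 0 \<or> s = 1" by auto
    then show ?thesis by auto
  next
    case False
    then have "(2 :: nat) ^ 2 \<le> 2 ^ s" by (intro power_increasing) auto
    then show ?thesis using Suc by simp
  qed
qed simp

text \<open>Turns \<open>theta q r + 8 \<le> 2 * t\<close> into \<open>2 * r \<le> t\<close>, as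
  needed for \<open>floor_omega\<close>. It suffices to keep the leading term
  \<open>q ^ (r - 1)\<close> of \<open>theta q r\<close>.\<close>

lemma four_times_le_theta:
  assumes q: "2 \<le> q" and r: "1 \<le> r"
  shows "4 * real r \<le> theta q r + 8"
proof -
  obtain s where s: "r = Suc s" using r by (cases r) auto
  have "real (4 * s) \<le> real (2 ^ s + 4)" using four_times_le_two_power by (simp only: of_nat_le_iff)
  then have "4 * real s \<le> 2 ^ s + 4" by simp
  also have "(2 :: real) ^ s \<le> real q ^ s" using q by (intro power_mono) auto
  also have "real q ^ s * (real q - 1) \<le> real q ^ r - 1"
    using q one_le_power[of "real q" s] by (simp add: s algebra_simps)
  then have "real q ^ s \<le> theta q r"
    using q by (simp add: theta_def pos_le_divide_eq)
  finally show ?thesis by (simp add: s)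
qed

section \<open>From Kurz's bound to \<open>g_bound\<close>, and the final comparison\<close>

text \<open>Kurz's bound has \<open>(q - 1) * (t - 1)\<close> where \<open>g_bound\<close> has
  \<open>(q - 1) * (t - 2) + c1 - c2\<close>. Since \<open>c1 \<le> q - 1\<close> and
  \<open>c2 \<ge> 0\<close>, \<open>g_bound\<close> is at least as large.\<close>

lemma card_partial_spread_le_g_bound:
  fixes S :: "('a::{field,finite} ^ 'n) set set"
  assumes S: "partial_spread t S" and nt: "CARD('n) > t" and r: "CARD('n) mod t = r" and t0: "0 < t"
    and t: "real t \<le> theta CARD('a) r" "theta CARD('a) r + 2 \<le> 2 * real t"
  shows "real (card S) \<le> g_bound CARD('a) CARD('n) t"
proof -
  define q where "q = CARD('a)"
  have q: "2 \<le> q" using card_field_ge_2 q_def by metis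
  obtain N where N: "theta q r = real N" "q ^ r - 1 = (q - 1) * N"
    using ex_theta_eq_of_nat[OF q] .
  have tN: "t \<le> N" "N + 2 \<le> 2 * t" using t N by (simp_all flip: q_def)
  \<comment> \<open>The lower bound on \<open>t\<close> is exactly \<open>Suc z \<le> t\<close>; the
    upper one keeps the subtraction from truncating.\<close>
  define z where "z = N + 1 - t"
  have z: "Suc z \<le> t" "N = t - 1 + z" using tN t0 by (auto simp: z_def)
  define k where "k = CARD('n) div t"
  have n: "CARD('n) = t * k + r" using r by (simp add: k_def mult.commute flip: r)
  have "k \<noteq> 0" using n nt r t0 by (metis add_0 mod_less_divisor mult_0_right not_less_iff_gr_or_eq)
  then obtain j where k: "k = Suc j" by (cases k) auto
  have "q ^ t - 1 dvd q ^ (t * j) - 1"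
  proof -
    have "int q ^ t - 1 dvd (int q ^ t) ^ j - 1" using power_diff_1_eq[of "int q ^ t" j] by simp
    then show ?thesis using q by (simp add: of_nat_diff power_mult flip: int_dvd_int_iff)
  qed
  then obtain M where M: "q ^ (t * j) - 1 = (q ^ t - 1) * M" ..
  \<comment> \<open>Since \<open>n = t + r + t * j\<close>, the quotient in the bound is
    \<open>q ^ (t + r) * M\<close>.\<close>
  define L where "L = q ^ r * M"
  have qn: "q ^ CARD('n) = q ^ (t + r) * q ^ (t * j)"
    unfolding n k by (simp flip: power_add add: algebra_simps)
  have L: "L * q ^ t * (q ^ t - 1) = q ^ CARD('n) - q ^ (t + r)"
  proof -
    have "L * q ^ t * (q ^ t - 1) = q ^ (t + r) * ((q ^ t - 1) * M)"
      by (simp add: L_def power_add mult_ac)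
    also have "\<dots> = q ^ CARD('n) - q ^ (t + r)" unfolding M[symmetric] qn by (simp add: diff_mult_distrib2)
    finally show ?thesis .
  qed
  have le: "q ^ (t + r) \<le> q ^ CARD('n)" unfolding qn using q by simp
  have "card S \<le> L * q ^ t + 1 + z * (q - 1)"
    unfolding q_def
    by (rule card_partial_spread_le[OF S _ z(1), where r = r])
       (use nt L le N(2) z(2) in \<open>simp_all add: q_def\<close>)
  then have "real (card S) \<le> real (L * q ^ t + 1 + z * (q - 1))" by (simp only: of_nat_le_iff)
  also have "\<dots> = real L * real q ^ t + 1 + real z * (real q - 1)" using q by (simp add: of_nat_diff)
  also have "real L * real q ^ t = (real q ^ CARD('n) - real q ^ (t + r)) / (real q ^ t - 1)"
  proof -
    have "real L * real q ^ t * (real q ^ t - 1) = real q ^ CARD('n) - real q ^ (t + r)"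
      using arg_cong[OF L, of real] le q by (simp add: of_nat_diff)
    moreover have "1 < real q ^ t" using q t0 by (intro one_less_power) auto
    ultimately show ?thesis by (simp add: eq_divide_eq)
  qed
  also have "real z * (real q - 1) = real q ^ r - 1 - (real q - 1) * (real t - 1)"
  proof -
    have z: "real z = real N + 1 - real t" using tN by (simp add: z_def of_nat_diff)
    show ?thesis
      using theta_times[OF q, of r] unfolding N(1) z by (simp add: algebra_simps)
  qed
  also have "of_int (c1 q t) \<le> real q - 1"
  proof -
    have "c1 q t < int q" using q by (simp add: c1_def)
    then have "c1 q t \<le> int q - 1" by simp
    then have "real_of_int (c1 q t) \<le> of_int (int q - 1)" by (simp only: of_int_le_iff)
    then show ?thesis by simp
  qed
  moreover have "0 \<le> real_of_int (c2 q t)" by (simp add: c2_def)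
  ultimately show ?thesis unfolding g_bound_def q_def[symmetric] r Let_def
    by (simp add: algebra_simps)
qed

lemma mu_attained:
  obtains S :: "('a::{field,finite} ^ 'n) set set"
    where "partial_spread t S" "mu TYPE('a ^ 'n) t = card S"
proof -
  have "mu TYPE('a ^ 'n) t \<in> {card S |S :: ('a ^ 'n) set set. partial_spread t S}"
    unfolding mu_def
  proof (rule Max_in)
    have "partial_spread t ({} :: ('a ^ 'n) set set)" by (simp add: partial_spread_def)
    then show "{card S |S :: ('a ^ 'n) set set. partial_spread t S} \<noteq> {}" by blast
  qed simp
  then show ?thesis using that by blast
qed

theorem corollary8:
  fixes q n t r :: nat
  assumes "primepow q"
    and "n > t" and "t > r" and "r \<ge> 2"
    and "[r = n] (mod t)"
  shows "(2 * r \<le> t \<and> real t \<le> theta q r \<longrightarrow>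
            g_bound q n t - f_bound q n t =
              of_int \<lfloor>real q ^ r / 2\<rfloor> - (real q - 1) * (real t - 2)
                - of_int (c1 q t) + of_int (c2 q t))
       \<and> ((q > 2 \<and> \<lceil>theta q r / 2\<rceil> + 4 \<le> int t \<or>
           q = 2 \<and> \<lceil>theta q r / 2\<rceil> + 5 \<le> int t)
            \<and> real t \<le> theta q r \<longrightarrow>
            g_bound q n t - f_bound q n t < 0
          \<and> (CARD('a::{field,finite}) = q \<and> CARD('n::finite) = n \<longrightarrow>
               real (mu TYPE('a ^ 'n) t) \<le> g_bound q n t
             \<and> g_bound q n t < f_bound q n t))"
proof -
  have q: "2 \<le> q" using primepow_gt_Suc_0[OF assms(1)] by simp
  have nr: "n mod t = r" using assms(3,5) by (simp add: cong_def)
  show ?thesis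
  proof (intro conjI impI)
    assume "2 * r \<le> t \<and> real t \<le> theta q r"
    then show "g_bound q n t - f_bound q n t =
        of_int \<lfloor>real q ^ r / 2\<rfloor> - (real q - 1) * (real t - 2) - of_int (c1 q t) + of_int (c2 q t)"
      using q nr assms(4) by (intro g_bound_minus_f_bound) auto
  next
    assume H: "(q > 2 \<and> \<lceil>theta q r / 2\<rceil> + 4 \<le> int t \<or>
           q = 2 \<and> \<lceil>theta q r / 2\<rceil> + 5 \<le> int t) \<and> real t \<le> theta q r"
    \<comment> \<open>The ceilings are dropped here; doubling turns the offsets \<open>4\<close> and
      \<open>5\<close> into \<open>8\<close> and \<open>10\<close>.\<close>
    have t: "2 < q \<and> theta q r + 8 \<le> 2 * real t \<or> q = 2 \<and> theta q r + 10 \<le> 2 * real t"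
      using H by linarith
    then have t8: "theta q r + 8 \<le> 2 * real t" by auto
    have "2 * r \<le> t" using four_times_le_theta[of q r] q assms(4) t8 by linarith
    then have eq: "g_bound q n t - f_bound q n t =
        of_int \<lfloor>real q ^ r / 2\<rfloor> - (real q - 1) * (real t - 2) - of_int (c1 q t) + of_int (c2 q t)"
      using q nr assms(4) by (intro g_bound_minus_f_bound) auto
    have c1: "0 \<le> real_of_int (c1 q t)" using q by (simp add: c1_def)
    have c2: "real_of_int (c2 q t) \<le> real q" by (simp add: c2_def)
    have fl: "real_of_int \<lfloor>real q ^ r / 2\<rfloor> \<le> real q ^ r / 2" by (rule of_int_floor_le)
    show less: "g_bound q n t - f_bound q n t < 0"
      using t
    proof
      \<comment> \<open>The difference comes out at most \<open>5 / 2 - q\<close>, negative from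
        \<open>q = 3\<close> on but not for \<open>q = 2\<close>, which explains the larger offset
        there.\<close>
      assume *: "2 < q \<and> theta q r + 8 \<le> 2 * real t"
      then have "(real q - 1) * (theta q r + 4) \<le> (real q - 1) * (2 * (real t - 2))"
        using q by (intro mult_left_mono) auto
      then have "real q ^ r - 1 + 4 * (real q - 1) \<le> 2 * ((real q - 1) * (real t - 2))"
        using theta_times[OF q, of r] by (simp add: algebra_simps)
      moreover have "3 \<le> real q" using * by simp
      moreover have "F - P - c + d < 0"
        if "b - 1 + 4 * (x - 1) \<le> 2 * P" "3 \<le> x" "0 \<le> c" "d \<le> x" "F \<le> b / 2"
        for F P c d b x :: real
        using that by argo
      ultimately show ?thesis unfolding eq using c1 c2 fl by blast
    next
      assume *: "q = 2 \<and> theta q r + 10 \<le> 2 * real t"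
      then have "real q ^ r - 1 + 10 \<le> 2 * real t" by (auto simp: theta_def)
      then show ?thesis unfolding eq using c1 c2 fl * by simp
    qed
    then show "g_bound q n t < f_bound q n t" by simp
    assume card: "CARD('a) = q \<and> CARD('n) = n"
    obtain S :: "('a ^ 'n) set set"
      where S: "partial_spread t S" "mu TYPE('a ^ 'n) t = card S" by (rule mu_attained)
    show "real (mu TYPE('a ^ 'n) t) \<le> g_bound q n t"
      using card_partial_spread_le_g_bound[OF S(1), of r] card assms nr H t8 S(2) by simp
  qed
qed

end
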